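(* Let $F=\{\tau\in\mathbb{H} : |\tau|\ge1,\ 0\le\mathrm{Re}(\tau)\le\frac12\}$, and for $\tau\in F$ let $\Lambda_\tau=\mathbb{Z}+\mathbb{Z}\tau\subset\mathbb{C}=\mathbb{E}^2$. Let $l_1=\{\tau\in F:\mathrm{Re}(\tau)=0\}$, $l_2=\{\tau\in F:\mathrm{Re}(\tau)=\frac12\}$, $l_3=\{\tau\in F:|\tau|=1\}$. Then for $\tau\in F$ the differential of the $\Theta$ map is degenerate at $\Lambda_\tau$ if and only if $\tau\in l_1\cup l_2\cup l_3$.
   Context: $\mathbb{H}$ is the upper half plane. For a positive definite symmetric real $2\times2$ matrix $A$, $\Theta_A(z)=\sum_{\lambda\in\mathbb{Z}^2}\exp(2\pi i({}^t\lambda A\lambda)z)$ for $z\in\mathbb{H}$; for a symmetric real matrix $B$, $\partial_B\Theta_A(z)=\frac{1}{2\pi iz}\frac{\partial}{\partial t}\Theta_{A+tB}(z)|_{t=0}=\sum_{\lambda\in\mathbb{Z}^2}({}^t\lambda B\lambda)\exp(2\pi i({}^t\lambda A\lambda)z)$. Let $T_A^0=\{B\text{ symmetric}:\mathrm{tr}(BA^{-1})=0\}$. For a lattice $\Lambda\subset\mathbb{E}^2$ with Gram matrix $A$ (with respect to some basis), the differential of the $\Theta$ map is degenerate at $\Lambda$ if $B\mapsto\partial_B\Theta_A$ is not injective on the two-dimensional space $T_A^0$. Equivalently, $\Theta_{h_1}\Theta_{h_2}'-\Theta_{h_1}'\Theta_{h_2}=0$, where $h_1(x,y)=x^2-y^2$,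 $h_2(x,y)=xy$, and $\Theta_{h_i}(z)=\sum_{\lambda\in\Lambda}h_i(\lambda)\exp(2\pi i\|\lambda\|^2z)$. *)

theory Defs
  imports "HOL-Analysis.Analysis"
begin

definition upper_half_plane :: "complex set" where
  "upper_half_plane = {z. Im z > 0}"

definition quad_form :: "real^2^2 \<Rightarrow> int^2 \<Rightarrow> real" where
  "quad_form A l = (let x = (\<chi> i. real_of_int (l $ i)) in x \<bullet> (A *v x))"

text \<open>The series converges absolutely when \<open>A\<close> is positive definite and \<open>Im z > 0\<close>; elsewhere
  the value carries no meaning.\<close>

definition Theta :: "real^2^2 \<Rightarrow> complex \<Rightarrow> complex" where
  "Theta A z = (\<Sum>\<^sub>\<infinity>l\<in>(UNIV :: (int^2) set).
     exp (2 * of_real pi * \<i> * of_real (quad_form A l) * z))"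

definition dTheta :: "real^2^2 \<Rightarrow> real^2^2 \<Rightarrow> complex \<Rightarrow> complex" where
  "dTheta B A z =
     vector_derivative (\<lambda>t. Theta (A + t *\<^sub>R B) z) (at 0) / (2 * of_real pi * \<i> * z)"

definition T0 :: "real^2^2 \<Rightarrow> (real^2^2) set" where
  "T0 A = {B. transpose B = B \<and> trace (B ** matrix_inv A) = 0}"

text \<open>The Euclidean plane is \<^typ>\<open>complex\<close>, with inner product \<open>v \<bullet> w = Re (v * cnj w)\<close>.\<close>

definition lattice_basis :: "complex set \<Rightarrow> complex^2 \<Rightarrow> bool" where
  "lattice_basis L b \<longleftrightarrow>
     b $ 1 \<noteq> b $ 2 \<and> independent {b $ 1, b $ 2} \<and>
     L = {of_int m * b $ 1 + of_int n * b $ 2 | m n. True}"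

definition gram_matrix :: "complex^2 \<Rightarrow> real^2^2" where
  "gram_matrix b = (\<chi> i j. b $ i \<bullet> b $ j)"

text \<open>Elements of the image are functions on the upper half plane, hence the restriction.
  A change of basis replaces \<open>A\<close> by \<open>transpose U ** A ** U\<close> with \<open>U\<close> integral and unimodular, and
  \<open>B\<close> correspondingly, so the condition does not depend on the basis chosen.\<close>

definition Theta_degenerate_at :: "complex set \<Rightarrow> bool" where
  "Theta_degenerate_at L \<longleftrightarrow>
     (\<exists>b. lattice_basis L b \<and>
        \<not> inj_on (\<lambda>B. \<lambda>z\<in>upper_half_plane. dTheta B (gram_matrix b) z) (T0 (gram_matrix b)))"

definition Lambda :: "complex \<Rightarrow> complex set" where
  "Lambda \<tau> = {of_int m + of_int n * \<tau> | m n. True}"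

definition F :: "complex set" where
  "F = {\<tau> \<in> upper_half_plane. norm \<tau> \<ge> 1 \<and> 0 \<le> Re \<tau> \<and> Re \<tau> \<le> 1/2}"

definition l1 :: "complex set" where
  "l1 = {\<tau> \<in> F. Re \<tau> = 0}"

definition l2 :: "complex set" where
  "l2 = {\<tau> \<in> F. Re \<tau> = 1/2}"

definition l3 :: "complex set" where
  "l3 = {\<tau> \<in> F. norm \<tau> = 1}"

end

theory Submission
  imports Defs "HOL-Complex_Analysis.Cauchy_Integral_Formula"
begin

text \<open>
  Differentiating termwise, \<open>dTheta B A z\<close> is the series of the terms
  \<open>quad_form B l * exp (2 \<pi> \<i> (quad_form A l) z)\<close> (\<open>dTheta_has_sum\<close>). So \<open>B\<close> and \<open>B'\<close> have
  the same image exactly when \<open>D = B - B'\<close> sums to zero over every shell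
  \<open>{l. quad_form A l = q}\<close>; only two of these shells matter.

  Suppose that \<open>\<tau>\<close> lies on none of the three curves. Then the shortest nonzero vectors of the lattice
  are \<open>\<plusminus>1\<close>, and the shortest vectors that are not integers are \<open>\<plusminus>\<tau>\<close>
  (\<open>reduced_short_vectors\<close>). Letting \<open>z\<close> tend to \<open>\<i>\<infinity>\<close> isolates the lowest shell on which
  \<open>D\<close> does not vanish (\<open>lowest_shell\<close>). Applied first to the shell of \<open>1\<close>, this gives
  \<open>D(1) = 0\<close>, hence \<open>D = 0\<close> on all integers; applied next to the shell of \<open>\<tau>\<close>, it gives
  \<open>D(\<tau>) = 0\<close>. In the basis \<open>1, \<tau>\<close> only the off-diagonal entry of \<open>D\<close> is left, and the trace
  condition says that this entry times \<open>Re \<tau>\<close> is zero. Since \<open>Re \<tau> > 0\<close>, \<open>D = 0\<close>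
  (\<open>symmetric_traceless_eq_0\<close>). The second step works in an arbitrary lattice basis, because the
  trace condition is transported by a change of basis.

  Conversely, on each of the three curves the lattice has a reflection symmetry that is not \<open>\<plusminus>1\<close>.
  It splits the two-dimensional space \<open>T0 A\<close> into eigenlines, and for a form \<open>B\<close> with eigenvalue
  \<open>-1\<close> the terms of the series cancel in pairs (\<open>degenerate_of_symmetry\<close>).
\<close>

section \<open>Gaussian sums and quadratic forms on the integer lattice\<close>

abbreviation real_vec :: "int^2 \<Rightarrow> real^2" where
  "real_vec l \<equiv> (\<chi> i. real_of_int (l $ i))"

lemma norm_real_vec_sq: "(norm (real_vec l))\<^sup>2 = (real_of_int (l $ 1))\<^sup>2 + (real_of_int (l $ 2))\<^sup>2"
  by (simp add: norm_vec_def L2_set_def sum_2)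

lemma summable_exp_int:
  assumes "c > (0::real)"
  shows "(\<lambda>m::int. exp (- c * \<bar>real_of_int m\<bar>)) summable_on UNIV"
proof -
  have nat: "(\<lambda>n::nat. exp (- c * real n)) summable_on UNIV"
  proof (rule norm_summable_imp_summable_on)
    have "(\<lambda>n. norm (exp (- c * real n))) = (\<lambda>n. exp (- c) ^ n)"
      by (rule ext) (simp flip: exp_of_nat_mult add: mult.commute)
    then show "summable (\<lambda>n. norm (exp (- c * real n)))"
      using assms by (simp add: summable_geometric)
  qed
  have "(\<lambda>m::int. exp (- c * \<bar>real_of_int m\<bar>)) summable_on range int"
    by (subst summable_on_reindex) (use nat in \<open>auto simp: o_def\<close>)
  moreover have "(\<lambda>m::int. exp (- c * \<bar>real_of_int m\<bar>)) summable_on range (\<lambda>n. - int n)"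
    by (subst summable_on_reindex) (use nat in \<open>auto simp: o_def inj_on_def\<close>)
  ultimately have "(\<lambda>m::int. exp (- c * \<bar>real_of_int m\<bar>)) summable_on (range int \<union> range (\<lambda>n. - int n))"
    by (rule summable_on_union)
  moreover have "range int \<union> range (\<lambda>n. - int n) = UNIV"
  proof -
    have "m \<in> range int \<union> range (\<lambda>n. - int n)" for m
      by (cases m rule: int_cases2) auto
    then show ?thesis by blast
  qed
  ultimately show ?thesis by simp
qed

lemma summable_gaussian_lattice:
  assumes "c > (0::real)"
  shows "(\<lambda>l. exp (- c * (norm (real_vec l))\<^sup>2)) summable_on UNIV"
proof -
  let ?e = "\<lambda>m::int. exp (- c * \<bar>real_of_int m\<bar>)"
  have e: "(?e has_sum infsum ?e UNIV) UNIV"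
    using summable_exp_int[OF assms] by (rule has_sum_infsum)
  have "(\<lambda>p. ?e (fst p) * ?e (snd p)) summable_on (UNIV \<times> UNIV)"
    by (rule summable_on_SigmaI[where g="\<lambda>x. ?e x * infsum ?e UNIV"])
       (use has_sum_cmult_right[OF e] summable_on_cmult_left[OF summable_exp_int[OF assms]] in auto)
  then have prod: "(\<lambda>l::int^2. ?e (l $ 1) * ?e (l $ 2)) summable_on UNIV"
    by (subst summable_on_reindex_bij_witness[where S=UNIV and T=UNIV
          and i="\<lambda>p. vector [fst p, snd p]" and j="\<lambda>l. (l $ 1, l $ 2)"
          and h="\<lambda>p. ?e (fst p) * ?e (snd p)"])
       (auto simp: vec_eq_iff forall_2)
  have sq: "\<bar>real_of_int m\<bar> \<le> (real_of_int m)\<^sup>2" for m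
  proof (cases "m = 0")
    case False
    then have "\<bar>real_of_int m\<bar> \<ge> 1" by linarith
    from self_le_power[OF this, of 2] show ?thesis by simp
  qed simp
  show ?thesis
  proof (rule summable_on_comparison_test[OF prod])
    fix l :: "int^2"
    have "c * (\<bar>real_of_int (l $ 1)\<bar> + \<bar>real_of_int (l $ 2)\<bar>) \<le> c * (norm (real_vec l))\<^sup>2"
      unfolding norm_real_vec_sq using assms sq by (intro mult_left_mono add_mono) auto
    then show "exp (- c * (norm (real_vec l))\<^sup>2) \<le> ?e (l $ 1) * ?e (l $ 2)"
      by (simp flip: exp_add add: algebra_simps)
  qed auto
qed

lemma quad_form_add_scaleR: "quad_form (A + t *\<^sub>R B) l = quad_form A l + t * quad_form B l"
  by (simp add: quad_form_def Let_def matrix_vector_mult_add_rdistrib inner_add_right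
      scaleR_matrix_vector_assoc[symmetric])

lemma quad_form_diff: "quad_form (A - B) l = quad_form A l - quad_form B l"
  using quad_form_add_scaleR[of A "-1" B l] by simp

lemma quad_form_explicit:
  "quad_form A l = A $ 1 $ 1 * (of_int (l $ 1))\<^sup>2
     + (A $ 1 $ 2 + A $ 2 $ 1) * (of_int (l $ 1) * of_int (l $ 2)) + A $ 2 $ 2 * (of_int (l $ 2))\<^sup>2"
  by (simp add: quad_form_def Let_def matrix_vector_mult_def inner_vec_def sum_2
      power2_eq_square algebra_simps)

text \<open>The perturbation \<open>t * quad_form B l\<close> of the exponent can be absorbed, for small \<open>t\<close>, by half of
  the Gaussian decay; this needs the two forms to be comparable.\<close>

lemma quad_form_bounded:
  obtains K where "K > 0" "\<And>l. \<bar>quad_form B l\<bar> \<le> K * (norm (real_vec l))\<^sup>2"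
proof
  let ?K = "1 + onorm ((*v) B)"
  have pos: "onorm ((*v) B) \<ge> 0"
    by (rule onorm_pos_le) (simp add: matrix_vector_mul_bounded_linear)
  then show "?K > 0" by linarith
  show "\<bar>quad_form B l\<bar> \<le> ?K * (norm (real_vec l))\<^sup>2" for l
  proof -
    have "\<bar>quad_form B l\<bar> \<le> norm (real_vec l) * norm (B *v real_vec l)"
      unfolding quad_form_def Let_def by (rule Cauchy_Schwarz_ineq2)
    also have "\<dots> \<le> norm (real_vec l) * (onorm ((*v) B) * norm (real_vec l))"
      by (intro mult_left_mono onorm) (auto simp: matrix_vector_mul_bounded_linear)
    also have "\<dots> \<le> ?K * (norm (real_vec l))\<^sup>2"
      by (simp add: power2_eq_square algebra_simps)
    finally show ?thesis .
  qed
qed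

section \<open>Termwise differentiation\<close>

text \<open>The parameter \<open>t\<close> is allowed to be complex. Then the theta series is a locally uniform limit
  of holomorphic functions of \<open>t\<close>, so Weierstrass's theorem gives both convergence of the series of
  derivatives and its sum.\<close>

lemma dTheta_has_sum:
  assumes pd: "\<delta> > 0" "\<And>l. \<delta> * (norm (real_vec l))\<^sup>2 \<le> quad_form A l" and z: "Im z > 0"
  shows "((\<lambda>l. of_real (quad_form B l) * exp (2 * of_real pi * \<i> * of_real (quad_form A l) * z))
           has_sum dTheta B A z) UNIV"
proof -
  obtain K where K: "K > 0" "\<And>l. \<bar>quad_form B l\<bar> \<le> K * (norm (real_vec l))\<^sup>2"
    using quad_form_bounded by blast
  have z0: "z \<noteq> 0" using z by auto
  define r where "r = \<delta> * Im z / (2 * K * norm z)"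
  have r: "r > 0" using pd(1) z z0 K(1) by (simp add: r_def)
  define f where "f = (\<lambda>l w. exp (2 * of_real pi * \<i> *
      (of_real (quad_form A l) + w * of_real (quad_form B l)) * z))"
  define f' where "f' = (\<lambda>l w. 2 * of_real pi * \<i> * z * of_real (quad_form B l) * f l w)"
  have bound: "norm (f l w) \<le> exp (- (pi * \<delta> * Im z) * (norm (real_vec l))\<^sup>2)"
    if w: "w \<in> cball 0 r" for l w
  proof -
    let ?n = "(norm (real_vec l))\<^sup>2" and ?R = "Re (\<i> * w * z)"
    have "\<bar>?R\<bar> \<le> norm w * norm z"
      using abs_Re_le_cmod[of "\<i> * w * z"] by (simp add: norm_mult)
    also have "\<dots> \<le> r * norm z"
      using w by (intro mult_right_mono) auto
    also have "\<dots> = \<delta> * Im z / (2 * K)"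
      using z0 by (simp add: r_def)
    finally have "\<bar>quad_form B l\<bar> * \<bar>?R\<bar> \<le> (K * ?n) * (\<delta> * Im z / (2 * K))"
      using K by (intro mult_mono) auto
    also have "\<dots> = \<delta> * Im z * ?n / 2"
      using K(1) by simp
    finally have 1: "quad_form B l * ?R \<le> \<delta> * Im z * ?n / 2"
      by (metis abs_le_D1 abs_mult)
    have 2: "\<delta> * Im z * ?n \<le> quad_form A l * Im z"
      using mult_right_mono[OF pd(2)[of l], of "Im z"] z by (simp add: mult_ac)
    have "Re (2 * of_real pi * \<i> * (of_real (quad_form A l) + w * of_real (quad_form B l)) * z)
        = 2 * pi * (quad_form B l * ?R - quad_form A l * Im z)"
      by (simp add: algebra_simps)
    also have "\<dots> \<le> 2 * pi * (- (\<delta> * Im z * ?n / 2))"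
      using 1 2 by (intro mult_left_mono) auto
    also have "\<dots> = - (pi * \<delta> * Im z) * ?n" by simp
    finally show ?thesis by (simp add: f_def)
  qed
  have ulim: "uniform_limit (cball 0 r) (\<lambda>X w. \<Sum>l\<in>X. f l w) (\<lambda>w. \<Sum>\<^sub>\<infinity>l. f l w)
      (finite_subsets_at_top UNIV)"
    by (rule Weierstrass_m_test_general[OF bound summable_gaussian_lattice]) (use pd z in auto)
  have der: "(f l has_field_derivative f' l w) (at w)" for l w
    unfolding f_def f'_def by (auto intro!: derivative_eq_intros simp: mult_ac)
  have "\<forall>\<^sub>F X in finite_subsets_at_top UNIV. continuous_on (cball 0 r) (\<lambda>w. \<Sum>l\<in>X. f l w) \<and>
      (\<forall>w\<in>ball 0 r. ((\<lambda>w. \<Sum>l\<in>X. f l w) has_field_derivative (\<Sum>l\<in>X. f' l w)) (at w))"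
  proof (intro always_eventually allI conjI ballI)
    show sum_der: "((\<lambda>w. \<Sum>l\<in>X. f l w) has_field_derivative (\<Sum>l\<in>X. f' l w)) (at w)" for X w
      by (rule DERIV_sum) (rule der)
    show "continuous_on (cball 0 r) (\<lambda>w. \<Sum>l\<in>X. f l w)" for X
      using sum_der DERIV_isCont continuous_at_imp_continuous_on by blast
  qed
  from has_complex_derivative_uniform_limit[OF this ulim _ r]
  obtain g' where g': "\<And>w. w \<in> ball 0 r \<Longrightarrow>
      ((\<lambda>w. \<Sum>\<^sub>\<infinity>l. f l w) has_field_derivative g' w) (at w) \<and>
      ((\<lambda>X. \<Sum>l\<in>X. f' l w) \<longlongrightarrow> g' w) (finite_subsets_at_top UNIV)"
    by auto
  have "((\<lambda>w. \<Sum>\<^sub>\<infinity>l. f l w) has_field_derivative g' 0) (at (of_real 0))"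
    using g'[of 0] r by simp
  then have "((\<lambda>t. \<Sum>\<^sub>\<infinity>l. f l (of_real t)) has_vector_derivative g' 0) (at 0)"
    by (rule has_vector_derivative_real_field)
  moreover have "(\<lambda>t. \<Sum>\<^sub>\<infinity>l. f l (of_real t)) = (\<lambda>t. Theta (A + t *\<^sub>R B) z)"
    by (simp add: Theta_def f_def quad_form_add_scaleR)
  ultimately have dT: "dTheta B A z = g' 0 / (2 * of_real pi * \<i> * z)"
    by (simp add: dTheta_def vector_derivative_at)
  have "((\<lambda>l. f' l 0) has_sum g' 0) UNIV"
    using g'[of 0] r by (simp add: has_sum_def)
  then have "((\<lambda>l. f' l 0 / (2 * of_real pi * \<i> * z)) has_sum dTheta B A z) UNIV"
    unfolding dT divide_inverse by (rule has_sum_cmult_left)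
  then show ?thesis
    using z0 by (simp add: f'_def f_def)
qed

section \<open>Isolating the lowest shell\<close>

text \<open>After multiplication by \<open>exp (y * q)\<close> the terms in \<open>S\<close> are constant in \<open>y\<close> and the others tend to
  \<open>0\<close> as \<open>y\<close> tends to infinity. The terms at \<open>y = 1\<close> dominate those at all \<open>y \<ge> 1\<close>, so limit and
  sum may be exchanged.\<close>

lemma dirichlet_series_lowest_coeff:
  fixes g :: "'a \<Rightarrow> complex" and Q :: "'a \<Rightarrow> real"
  assumes "finite S" and shell: "\<And>l. l \<in> S \<Longrightarrow> Q l = q"
    and above: "\<And>l. l \<notin> S \<Longrightarrow> g l \<noteq> 0 \<Longrightarrow> Q l > q"
    and zero: "\<And>y. y > 0 \<Longrightarrow> ((\<lambda>l. g l * of_real (exp (- (y * Q l)))) has_sum 0) UNIV"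
  shows "sum g S = 0"
proof -
  define f where "f = (\<lambda>l y. g l * of_real (exp (- (y * (Q l - q)))))"
  have f_eq: "f l y = of_real (exp (y * q)) * (g l * of_real (exp (- (y * Q l))))" for l y
    by (simp add: f_def right_diff_distrib exp_diff exp_minus divide_inverse mult_ac)
  have f0: "((\<lambda>l. f l y) has_sum 0) UNIV" if "y > 0" for y
    using has_sum_cmult_right[OF zero[OF that], of "of_real (exp (y * q))"] by (simp add: f_eq)
  have "(\<lambda>l. norm (f l 1)) summable_on UNIV"
    using f0[of 1] summable_on_iff_abs_summable_on_complex has_sum_imp_summable by fastforce
  moreover have "norm (f l y) \<le> norm (f l 1)" if "y \<in> {1..}" for l y
  proof (cases "g l = 0")
    case False
    then have "Q l - q \<ge> 0" using shell above by (cases "l \<in> S") force+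
    then have "1 * (Q l - q) \<le> y * (Q l - q)" using that by (intro mult_right_mono) auto
    then show ?thesis by (simp add: f_def norm_mult mult_left_mono)
  qed (simp add: f_def)
  ultimately have ul: "uniform_limit {1..} (\<lambda>X y. \<Sum>l\<in>X. f l y) (\<lambda>y. \<Sum>\<^sub>\<infinity>l. f l y)
      (finite_subsets_at_top UNIV)"
    by (intro Weierstrass_m_test_general) auto
  have lim: "((f l) \<longlongrightarrow> (if l \<in> S then g l else 0)) at_top" for l
  proof (cases "l \<in> S \<or> g l = 0")
    case True
    then show ?thesis by (auto simp: f_def shell)
  next
    case False
    then have "Q l - q > 0" using above by simp
    then have "((\<lambda>y. exp (- (y * (Q l - q)))) \<longlongrightarrow> 0) at_top"
      by real_asymp
    from tendsto_mult_right_zero[OF tendsto_of_real[OF this, unfolded of_real_0], of "g l"] False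
    show ?thesis by (simp add: f_def)
  qed
  have S: "((\<lambda>l. if l \<in> S then g l else 0) has_sum sum g S) UNIV"
    using has_sum_finite[OF \<open>finite S\<close>, of g]
    by (rule has_sum_cong_neutral[THEN iffD1, rotated -1]) auto
  have "((\<lambda>y. \<Sum>\<^sub>\<infinity>l. f l y) \<longlongrightarrow> sum g S) at_top"
    by (rule swap_uniform_limit'[OF _ S[unfolded has_sum_def] ul])
       (auto intro!: always_eventually tendsto_sum lim eventually_ge_at_top)
  moreover have "((\<lambda>y. \<Sum>\<^sub>\<infinity>l. f l y) \<longlongrightarrow> 0) at_top"
    by (rule tendsto_eventually) (use eventually_gt_at_top[of 0] in eventually_elim, auto intro!: infsumI f0)
  ultimately show ?thesis
    by (metis tendsto_unique trivial_limit_at_top_linorder)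
qed


section \<open>The trace condition in an arbitrary basis\<close>

definition bilinear_form :: "real^2^2 \<Rightarrow> real \<Rightarrow> real \<Rightarrow> real \<Rightarrow> real \<Rightarrow> real" where
  "bilinear_form A p1 p2 r1 r2 = A$1$1 * p1 * r1 + A$1$2 * p1 * r2 + A$2$1 * p2 * r1 + A$2$2 * p2 * r2"

text \<open>The inverse of a two-by-two matrix is its adjugate divided by the determinant, so the
  condition defining \<open>T0 A\<close> is a bilinear equation in the entries of both matrices.\<close>

lemma trace_mult_inv_2:
  fixes A B :: "real^2^2"
  assumes "det A \<noteq> 0"
  shows "det A * trace (B ** matrix_inv A)
    = B$1$1 * A$2$2 - B$1$2 * A$2$1 - B$2$1 * A$1$2 + B$2$2 * A$1$1"
proof -
  define M where "M = matrix_inv A"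
  have "A ** M = mat 1"
    using assms someI_ex[of "\<lambda>M. A ** M = mat 1 \<and> M ** A = mat 1"]
    unfolding M_def matrix_inv_def invertible_det_nz[symmetric] invertible_def by blast
  then have "(A ** M) $ i $ j = mat 1 $ i $ j" for i j by simp
  from this[of 1 1] this[of 1 2] this[of 2 1] this[of 2 2]
  have "A$1$1 * M$1$1 + A$1$2 * M$2$1 = 1" "A$1$1 * M$1$2 + A$1$2 * M$2$2 = 0"
    "A$2$1 * M$1$1 + A$2$2 * M$2$1 = 0" "A$2$1 * M$1$2 + A$2$2 * M$2$2 = 1"
    by (simp_all add: matrix_matrix_mult_def sum_2 mat_def)
  then have "det A * M$1$1 = A$2$2" "det A * M$1$2 = - A$1$2"
    "det A * M$2$1 = - A$2$1" "det A * M$2$2 = A$1$1"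
    unfolding det_2 by algebra+
  then have "det A * (B$1$1 * M$1$1 + B$1$2 * M$2$1 + B$2$1 * M$1$2 + B$2$2 * M$2$2)
    = B$1$1 * A$2$2 - B$1$2 * A$2$1 - B$2$1 * A$1$2 + B$2$2 * A$1$1"
    by (simp add: distrib_left mult.left_commute[of "det A"])
  then show ?thesis
    by (simp add: trace_def matrix_matrix_mult_def sum_2 M_def[symmetric] algebra_simps)
qed

text \<open>The expression in \<open>tr\<close> is the polarisation of the determinant, so passing to the basis
  \<open>(p1, p2), (r1, r2)\<close> multiplies it by the square of the determinant of the base change. In that basis
  the diagonal of \<open>D\<close> vanishes, and what remains is \<open>-2\<close> times the product of the off-diagonal entries of
  \<open>D\<close> and \<open>A\<close>.\<close>

lemma symmetric_traceless_eq_0: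
  fixes D A :: "real^2^2"
  assumes sym: "D$1$2 = D$2$1" "A$1$2 = A$2$1"
    and tr: "D$1$1 * A$2$2 - D$1$2 * A$2$1 - D$2$1 * A$1$2 + D$2$2 * A$1$1 = 0"
    and det: "p1 * r2 - p2 * r1 \<noteq> 0"
    and zero: "bilinear_form D p1 p2 p1 p2 = 0" "bilinear_form D r1 r2 r1 r2 = 0"
    and A: "bilinear_form A p1 p2 r1 r2 \<noteq> 0"
  shows "D = 0"
proof -
  let ?d = "p1 * r2 - p2 * r1"
  have "bilinear_form D p1 p2 p1 p2 * bilinear_form A r1 r2 r1 r2 - 2 * bilinear_form D p1 p2 r1 r2 * bilinear_form A p1 p2 r1 r2
      + bilinear_form D r1 r2 r1 r2 * bilinear_form A p1 p2 p1 p2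
      = ?d\<^sup>2 * (D$1$1 * A$2$2 - D$1$2 * A$2$1 - D$2$1 * A$1$2 + D$2$2 * A$1$1)"
    by (simp add: sym bilinear_form_def power2_eq_square algebra_simps)
  then have D: "bilinear_form D p1 p2 r1 r2 = 0" using tr zero A by simp
  have "?d\<^sup>2 * D$1$1 = 0" "?d\<^sup>2 * D$1$2 = 0" "?d\<^sup>2 * D$2$2 = 0"
    using D zero sym unfolding bilinear_form_def by algebra+
  with det sym have "D$1$1 = 0" "D$1$2 = 0" "D$2$1 = 0" "D$2$2 = 0" by auto
  then show ?thesis by (simp add: vec_eq_iff forall_2)
qed

section \<open>Gram matrices of plane lattices\<close>

abbreviation lattice_vec :: "complex^2 \<Rightarrow> int^2 \<Rightarrow> complex" where
  "lattice_vec b l \<equiv> of_int (l $ 1) * b $ 1 + of_int (l $ 2) * b $ 2"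

lemma quad_form_gram: "quad_form (gram_matrix b) l = (norm (lattice_vec b l))\<^sup>2"
  unfolding quad_form_explicit gram_matrix_def cmod_power2
  by (simp add: inner_complex_def power2_eq_square algebra_simps)

lemma bilinear_gram:
  "bilinear_form (gram_matrix b) p1 p2 r1 r2
     = (of_real p1 * b $ 1 + of_real p2 * b $ 2) \<bullet> (of_real r1 * b $ 1 + of_real r2 * b $ 2)"
  by (simp add: bilinear_form_def gram_matrix_def inner_complex_def algebra_simps)

lemma quad_form_bilinear:
  "quad_form A l = bilinear_form A (of_int (l $ 1)) (of_int (l $ 2)) (of_int (l $ 1)) (of_int (l $ 2))"
  by (simp add: quad_form_explicit bilinear_form_def power2_eq_square algebra_simps)

lemma det_gram: "det (gram_matrix b) = (Im (cnj (b $ 1) * b $ 2))\<^sup>2"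
  by (simp add: det_2 gram_matrix_def inner_complex_def power2_eq_square algebra_simps)

lemma gram_symmetric: "gram_matrix b $ i $ j = gram_matrix b $ j $ i"
  by (simp add: gram_matrix_def inner_commute)

lemma independent_complex_iff:
  assumes "u \<noteq> (v :: complex)"
  shows "independent {u, v} \<longleftrightarrow> Im (cnj u * v) \<noteq> 0"
proof
  assume ind: "independent {u, v}"
  show "Im (cnj u * v) \<noteq> 0"
  proof
    assume *: "Im (cnj u * v) = 0"
    have u0: "u \<noteq> 0" using ind dependent_zero by blast
    define R where "R = Re (cnj u * v)"
    have "v = (R / (norm u)\<^sup>2) *\<^sub>R u"
    proof -
      have "cnj u * v = of_real R" using * by (simp add: R_def complex_eq_iff)
      then have "u * cnj u * v = of_real R * u" by (metis mult.assoc mult.commute)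
      then have "of_real ((norm u)\<^sup>2) * v = of_real R * u"
        by (simp only: complex_norm_square)
      then show ?thesis using u0 by (simp add: scaleR_conv_of_real field_simps)
    qed
    then have "v \<in> span {u}" by (metis span_base span_scale singletonI)
    moreover have "v \<notin> span {u}"
      using ind assms by (metis independent_insert insert_commute singletonD)
    ultimately show False by contradiction
  qed
next
  assume *: "Im (cnj u * v) \<noteq> 0"
  then have "v \<noteq> 0" by auto
  moreover have "u \<notin> span {v}"
    using * by (auto simp: span_singleton scaleR_conv_of_real)
  ultimately show "independent {u, v}"
    using assms by (simp add: independent_insert)
qed

text \<open>The map from coordinates to vectors is linear and injective on a finite-dimensional space, hence
  bounded below.\<close>

lemma gram_positive_definite:
  assumes nz: "Im (cnj (b $ 1) * b $ 2) \<noteq> 0"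
  obtains \<delta> where "\<delta> > 0" "\<And>l. \<delta> * (norm (real_vec l))\<^sup>2 \<le> quad_form (gram_matrix b) l"
proof -
  let ?V = "\<lambda>x::real^2. x $ 1 *\<^sub>R b $ 1 + x $ 2 *\<^sub>R b $ 2"
  have lin: "linear ?V"
    by (rule linearI) (auto simp: algebra_simps)
  have "inj ?V"
  proof (subst linear_injective_0[OF lin], intro allI impI)
    fix x assume "?V x = 0"
    then have "x $ 1 * Re (b $ 1) + x $ 2 * Re (b $ 2) = 0" "x $ 1 * Im (b $ 1) + x $ 2 * Im (b $ 2) = 0"
      by (auto simp: complex_eq_iff)
    then have "x $ 1 * (Re (b $ 1) * Im (b $ 2) - Im (b $ 1) * Re (b $ 2)) = 0"
      "x $ 2 * (Re (b $ 1) * Im (b $ 2) - Im (b $ 1) * Re (b $ 2)) = 0"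
      by algebra+
    then show "x = 0" using nz by (simp add: vec_eq_iff forall_2)
  qed
  from linear_inj_bounded_below_pos[OF lin this]
  obtain c where c: "c > 0" "\<And>x. c * norm x \<le> norm (?V x)" by blast
  show ?thesis
  proof (rule that[of "c\<^sup>2"])
    show "c\<^sup>2 * (norm (real_vec l))\<^sup>2 \<le> quad_form (gram_matrix b) l" for l
    proof -
      have "(c * norm (real_vec l))\<^sup>2 \<le> (norm (?V (real_vec l)))\<^sup>2"
        using c(2)[of "real_vec l"] c(1) by (intro power_mono) simp_all
      then show ?thesis
        by (simp add: quad_form_gram power_mult_distrib scaleR_conv_of_real)
    qed
  qed (use c in auto)
qed

text \<open>On the imaginary axis the difference of the two theta derivatives is a real Dirichlet series
  whose frequencies are the values of the Gram form. If the shell of \<open>p\<close> contributes only through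
  \<open>p\<close> and \<open>- p\<close>, these two contributions are equal and so both vanish.\<close>

lemma lowest_shell:
  assumes nz: "Im (cnj (b $ 1) * b $ 2) \<noteq> 0"
    and B: "\<And>z. z \<in> upper_half_plane \<Longrightarrow> dTheta B1 (gram_matrix b) z = dTheta B2 (gram_matrix b) z"
    and above: "\<And>l. l \<noteq> p \<Longrightarrow> l \<noteq> - p \<Longrightarrow> quad_form (B1 - B2) l \<noteq> 0 \<Longrightarrow>
        quad_form (gram_matrix b) l > quad_form (gram_matrix b) p"
  shows "quad_form (B1 - B2) p = 0"
proof -
  let ?A = "gram_matrix b"
  obtain \<delta> where \<delta>: "\<delta> > 0" "\<And>l. \<delta> * (norm (real_vec l))\<^sup>2 \<le> quad_form ?A l"
    using gram_positive_definite[OF nz] by blast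
  have even: "quad_form M (- l) = quad_form M l" for M l by (simp add: quad_form_explicit)
  have "(\<Sum>l\<in>{p, - p}. complex_of_real (quad_form (B1 - B2) l)) = 0"
  proof (rule dirichlet_series_lowest_coeff[where Q="quad_form ?A" and q="quad_form ?A p"])
    fix y :: real assume y: "y > 0"
    let ?z = "\<i> * of_real (y / (2 * pi))"
    have z: "Im ?z > 0" using y by simp
    have e: "exp (2 * of_real pi * \<i> * of_real (quad_form ?A l) * ?z)
        = of_real (exp (- (y * quad_form ?A l)))" for l
      by (simp add: exp_of_real[symmetric] algebra_simps)
    show "((\<lambda>l. complex_of_real (quad_form (B1 - B2) l) * of_real (exp (- (y * quad_form ?A l)))) has_sum 0) UNIV"
      using has_sum_add[OF dTheta_has_sum[OF \<delta> z, of B1]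
          has_sum_uminusI[OF dTheta_has_sum[OF \<delta> z, of B2]]] B[of ?z] z
      unfolding e quad_form_diff of_real_diff left_diff_distrib
      by (simp only: upper_half_plane_def mem_Collect_eq) simp
  qed (use above even in auto)
  then show ?thesis by (cases "p = - p") (auto simp: even simp flip: of_real_add)
qed

section \<open>Lattices off the three curves\<close>

text \<open>The squared norm is \<open>m\<^sup>2 + 2 (Re \<tau>) m n + \<bar>\<tau>\<bar>\<^sup>2 n\<^sup>2\<close>. The strict inequalities on \<open>\<tau>\<close>
  make this, for \<open>m\<close> and \<open>n\<close> both nonzero, exceed \<open>m\<^sup>2 - \<bar>m n\<bar> + n\<^sup>2 - 1 + \<bar>\<tau>\<bar>\<^sup>2\<close>, and
  \<open>m\<^sup>2 - \<bar>m n\<bar> + n\<^sup>2 \<ge> \<bar>m n\<bar> \<ge> 1\<close>.\<close>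

lemma reduced_short_vectors:
  assumes \<tau>: "norm \<tau> > 1" "0 < Re \<tau>" "Re \<tau> < 1/2"
    and le: "norm (of_int m + of_int n * \<tau>) \<le> norm \<tau>"
  shows "n = 0 \<or> m = 0 \<and> \<bar>n\<bar> = 1"
proof (rule ccontr)
  assume neg: "\<not> ?thesis"
  let ?x = "Re \<tau>" and ?c = "(norm \<tau>)\<^sup>2" and ?m = "\<bar>real_of_int m\<bar>" and ?n = "\<bar>real_of_int n\<bar>"
  have c: "?c > 1" using \<tau>(1) by (simp add: one_less_power)
  have h1: "(norm (of_int m + of_int n * \<tau>))\<^sup>2 \<le> ?c"
    using power_mono[OF le, of 2] by simp
  have h2: "(norm (of_int m + of_int n * \<tau>))\<^sup>2 = ?m\<^sup>2 + 2 * ?x * (of_int m * of_int n) + ?n\<^sup>2 * ?c"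
    by (simp only: cmod_power2) (simp add: power2_eq_square algebra_simps)
  have 1: "?m\<^sup>2 + 2 * ?x * (of_int m * of_int n) + (?n\<^sup>2 - 1) * ?c \<le> 0"
    using h1 unfolding h2 left_diff_distrib by linarith
  have n: "?n \<ge> 1" using neg by linarith
  then have n2: "?n\<^sup>2 \<ge> 1" by (rule one_le_power)
  show False
  proof (cases "m = 0")
    case True
    then have "(?n\<^sup>2 - 1) * ?c \<le> 0" using 1 by simp
    then have "?n\<^sup>2 \<le> 1" using c by (auto simp: mult_le_0_iff)
    then have "?n \<le> 1" by (simp add: abs_square_le_1)
    then show False using neg n True by linarith
  next
    case False
    then have m: "?m \<ge> 1" by linarith
    have mn: "?m * ?n \<ge> 1" using m n mult_mono[of 1 ?m 1 ?n] by simp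
    have "\<bar>2 * ?x * (of_int m * of_int n)\<bar> = 2 * ?x * (?m * ?n)"
      using \<tau> by (simp add: abs_mult)
    also have "\<dots> < 1 * (?m * ?n)" using \<tau> mn by (intro mult_strict_right_mono) auto
    finally have cross: "2 * ?x * (of_int m * of_int n) > - (?m * ?n)" by linarith
    have "(?n\<^sup>2 - 1) * ?c \<ge> (?n\<^sup>2 - 1) * 1"
      using n2 c by (intro mult_left_mono) auto
    then have nc: "(?n\<^sup>2 - 1) * ?c \<ge> ?n\<^sup>2 - 1" by (simp only: mult_1_right)
    have sq: "?m\<^sup>2 + ?n\<^sup>2 \<ge> 2 * (?m * ?n)"
      using sum_squares_bound[of ?m ?n] by (simp only: mult.assoc)
    have "False" if "P \<ge> 1" "t > - P" "C \<ge> N - 1" "M + N \<ge> 2 * P" "M + t + C \<le> 0" for P t C M N :: real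
      using that by linarith
    from this[OF mn cross nc sq 1] show False .
  qed
qed

lemma interior_not_degenerate:
  assumes \<tau>: "Im \<tau> > 0" "norm \<tau> > 1" "0 < Re \<tau>" "Re \<tau> < 1/2"
  shows "\<not> Theta_degenerate_at (Lambda \<tau>)"
proof
  assume "Theta_degenerate_at (Lambda \<tau>)"
  then obtain b B1 B2 where b: "lattice_basis (Lambda \<tau>) b"
    and T0: "B1 \<in> T0 (gram_matrix b)" "B2 \<in> T0 (gram_matrix b)" and ne: "B1 \<noteq> B2"
    and eq: "(\<lambda>z\<in>upper_half_plane. dTheta B1 (gram_matrix b) z)
           = (\<lambda>z\<in>upper_half_plane. dTheta B2 (gram_matrix b) z)"
    unfolding Theta_degenerate_at_def inj_on_def by blast
  let ?A = "gram_matrix b" and ?v = "lattice_vec b" and ?D = "B1 - B2"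
  have nz: "Im (cnj (b $ 1) * b $ 2) \<noteq> 0"
    using b independent_complex_iff by (auto simp: lattice_basis_def)
  have dT: "dTheta B1 ?A z = dTheta B2 ?A z" if "z \<in> upper_half_plane" for z
    using fun_cong[OF eq, of z] that by simp
  have v_inj: "l = k" if "?v l = ?v k" for l k
  proof -
    obtain \<delta> where \<delta>: "\<delta> > 0" "\<And>l. \<delta> * (norm (real_vec l))\<^sup>2 \<le> quad_form ?A l"
      using gram_positive_definite[OF nz] by blast
    have "?v (l - k) = 0" using that by (simp add: algebra_simps)
    then have "\<delta> * (norm (real_vec (l - k)))\<^sup>2 \<le> 0" using \<delta>(2)[of "l - k"] by (simp add: quad_form_gram)
    then have "real_vec (l - k) = 0" using \<delta>(1) by (simp add: mult_le_0_iff)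
    then show ?thesis by (simp add: vec_eq_iff)
  qed
  have L: "Lambda \<tau> = range ?v"
  proof -
    have "\<exists>l. x = ?v l" if "x = of_int m * b $ 1 + of_int n * b $ 2" for x m n
      using that by (intro exI[of _ "vector [m, n]"]) simp
    then show ?thesis using b unfolding lattice_basis_def by blast
  qed
  have "1 \<in> Lambda \<tau>" unfolding Lambda_def by (intro CollectI exI[of _ "1::int"] exI[of _ "0::int"]) simp
  moreover have "\<tau> \<in> Lambda \<tau>" unfolding Lambda_def by (intro CollectI exI[of _ "0::int"] exI[of _ "1::int"]) simp
  ultimately obtain p r where p: "?v p = 1" and r: "?v r = \<tau>"
    unfolding L by auto
  have coords: "\<exists>m n. l = m *s p + n *s r \<and> ?v l = of_int m + of_int n * \<tau>" for l
  proof -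
    have "?v l \<in> Lambda \<tau>" unfolding L by simp
    then obtain m n where mn: "?v l = of_int m + of_int n * \<tau>" unfolding Lambda_def by blast
    have "?v (m *s p + n *s r) = of_int m * ?v p + of_int n * ?v r" by (simp add: algebra_simps)
    then have "?v (m *s p + n *s r) = ?v l" using mn p r by simp
    then show ?thesis using v_inj mn by metis
  qed
  \<comment> \<open>Lattice vectors of norm at most \<open>1\<close> are \<open>0\<close> and \<open>\<plusminus>1\<close>, and the form vanishes at \<open>0\<close>.\<close>
  have D1: "quad_form ?D p = 0"
  proof (rule lowest_shell[OF nz dT])
    fix l assume l: "l \<noteq> p" "l \<noteq> - p" "quad_form ?D l \<noteq> 0"
    obtain m n where mn: "l = m *s p + n *s r" "?v l = of_int m + of_int n * \<tau>" using coords by blast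
    show "quad_form ?A p < quad_form ?A l"
    proof (rule ccontr)
      assume "\<not> ?thesis"
      then have "(norm (?v l))\<^sup>2 \<le> 1" by (simp add: quad_form_gram p)
      then have le: "norm (?v l) \<le> 1" by (simp add: power_le_one_iff abs_square_le_1)
      then have n0: "n = 0 \<or> m = 0 \<and> \<bar>n\<bar> = 1" using reduced_short_vectors[of \<tau> m n] \<tau> mn by simp
      have "n = 0"
        using n0
      proof
        assume "m = 0 \<and> \<bar>n\<bar> = 1"
        moreover from this have "\<bar>real_of_int n\<bar> = 1" by linarith
        ultimately have "norm (?v l) = norm \<tau>"
          unfolding mn(2) by (simp add: norm_mult)
        then show ?thesis using le \<tau>(2) by linarith
      qed
      then have "\<bar>m\<bar> \<le> 1" using le mn by (simp flip: of_int_abs)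
      then have "m = 0 \<or> m = 1 \<or> m = -1" by linarith
      then show False using l mn \<open>n = 0\<close> by (auto simp: quad_form_explicit vec_eq_iff)
    qed
  qed
  \<comment> \<open>Integers may have norm at most \<open>\<bar>\<tau>\<bar>\<close>, but there the form vanishes by the previous step.\<close>
  have D2: "quad_form ?D r = 0"
  proof (rule lowest_shell[OF nz dT])
    fix l assume l: "l \<noteq> r" "l \<noteq> - r" "quad_form ?D l \<noteq> 0"
    obtain m n where mn: "l = m *s p + n *s r" "?v l = of_int m + of_int n * \<tau>" using coords by blast
    show "quad_form ?A r < quad_form ?A l"
    proof (rule ccontr)
      assume "\<not> ?thesis"
      then have "(norm (?v l))\<^sup>2 \<le> (norm \<tau>)\<^sup>2" by (simp only: quad_form_gram r not_less)
      then have "norm (?v l) \<le> norm \<tau>" by (rule power2_le_imp_le) simp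
      then have "n = 0 \<or> m = 0 \<and> \<bar>n\<bar> = 1" using reduced_short_vectors[of \<tau> m n] \<tau> mn by simp
      then consider "n = 0" | "m = 0" "n = 1 \<or> n = -1" by linarith
      then show False
      proof cases
        case 1
        then have "quad_form ?D l = (of_int m)\<^sup>2 * quad_form ?D p"
          using mn by (simp add: quad_form_explicit power2_eq_square algebra_simps)
        then show False using l D1 by simp
      next
        case 2
        then show False using l mn by (auto simp: vec_eq_iff)
      qed
    qed
  qed
  have "?D = 0"
  proof (rule symmetric_traceless_eq_0)
    show "?D $ 1 $ 2 = ?D $ 2 $ 1"
      using T0 by (auto simp: T0_def transpose_def vec_eq_iff)
    show "?A $ 1 $ 2 = ?A $ 2 $ 1" by (rule gram_symmetric)
    have "trace (?D ** matrix_inv ?A) = 0"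
      using T0 by (simp add: T0_def trace_def matrix_matrix_mult_def sum_2 algebra_simps)
    then show "?D$1$1 * ?A$2$2 - ?D$1$2 * ?A$2$1 - ?D$2$1 * ?A$1$2 + ?D$2$2 * ?A$1$1 = 0"
      using trace_mult_inv_2[of ?A ?D] nz by (simp add: det_gram)
    have "Im (cnj (?v p) * ?v r) = (p$1 * r$2 - p$2 * r$1) * Im (cnj (b $ 1) * b $ 2)"
      by (simp add: algebra_simps)
    then show "of_int (p$1) * of_int (r$2) - of_int (p$2) * of_int (r$1) \<noteq> (0::real)"
      using \<tau>(1) by (auto simp: p r)
    show "bilinear_form ?D (of_int (p$1)) (of_int (p$2)) (of_int (p$1)) (of_int (p$2)) = 0"
      using D1 by (simp only: quad_form_bilinear)
    show "bilinear_form ?D (of_int (r$1)) (of_int (r$2)) (of_int (r$1)) (of_int (r$2)) = 0"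
      using D2 by (simp only: quad_form_bilinear)
    have "bilinear_form ?A (of_int (p$1)) (of_int (p$2)) (of_int (r$1)) (of_int (r$2)) = 1 \<bullet> \<tau>"
      using p r by (simp add: bilinear_gram)
    then show "bilinear_form ?A (of_int (p$1)) (of_int (p$2)) (of_int (r$1)) (of_int (r$2)) \<noteq> 0"
      using \<tau>(3) by (simp add: inner_complex_def)
  qed
  then show False using ne by simp
qed

section \<open>Lattices with a reflection symmetry\<close>

text \<open>The isometry \<open>\<sigma>\<close> permutes every shell and changes the sign of \<open>B\<close>, so the series for \<open>B\<close> equals
  its own negative. The condition \<open>tr\<close> is the trace condition for the basis \<open>1, \<tau>\<close>.\<close>

lemma degenerate_of_symmetry:
  assumes \<tau>: "Im \<tau> > 0"
    and \<sigma>: "\<And>l. \<sigma> (\<sigma> l) = l"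
    and A: "\<And>l. norm (of_int (\<sigma> l $ 1) + of_int (\<sigma> l $ 2) * \<tau>) = norm (of_int (l $ 1) + of_int (l $ 2) * \<tau>)"
    and B: "\<And>l. quad_form B (\<sigma> l) = - quad_form B l"
    and sym: "transpose B = B" and "B \<noteq> 0"
    and tr: "B$1$1 * (norm \<tau>)\<^sup>2 - 2 * B$1$2 * Re \<tau> + B$2$2 = 0"
  shows "Theta_degenerate_at (Lambda \<tau>)"
proof -
  define b :: "complex^2" where "b = vector [1, \<tau>]"
  have b[simp]: "b $ 1 = 1" "b $ 2 = \<tau>" by (simp_all add: b_def)
  let ?A = "gram_matrix b"
  have nz: "Im (cnj (b $ 1) * b $ 2) \<noteq> 0" using \<tau> by simp
  have "1 \<noteq> \<tau>" using \<tau> by auto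
  then have basis: "lattice_basis (Lambda \<tau>) b"
    using nz by (auto simp: lattice_basis_def Lambda_def independent_complex_iff)
  obtain \<delta> where \<delta>: "\<delta> > 0" "\<And>l. \<delta> * (norm (real_vec l))\<^sup>2 \<le> quad_form ?A l"
    using gram_positive_definite[OF nz] by blast
  have "bij \<sigma>" using \<sigma> by (metis involuntory_imp_bij)
  have dT: "dTheta B ?A z = dTheta 0 ?A z" if "z \<in> upper_half_plane" for z
  proof -
    have z: "Im z > 0" using that by (simp add: upper_half_plane_def)
    let ?t = "\<lambda>l. of_real (quad_form B l) * exp (2 * of_real pi * \<i> * of_real (quad_form ?A l) * z)"
    have "?t (\<sigma> l) = - ?t l" for l
      by (simp add: B quad_form_gram A)
    then have "infsum ?t UNIV = - infsum ?t UNIV"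
      using infsum_reindex_bij_betw[OF \<open>bij \<sigma>\<close>, of ?t] by (simp add: infsum_uminus)
    then have "dTheta B ?A z = 0"
      using infsumI[OF dTheta_has_sum[OF \<delta> z, of B]] by simp
    moreover have "dTheta 0 ?A z = 0"
      using infsumI[OF dTheta_has_sum[OF \<delta> z, of 0]] by (simp add: quad_form_explicit)
    ultimately show ?thesis by simp
  qed
  have "B $ 2 $ 1 = B $ 1 $ 2"
    using sym by (simp add: transpose_def vec_eq_iff)
  moreover have "?A$1$1 = 1" "?A$1$2 = Re \<tau>" "?A$2$1 = Re \<tau>" "?A$2$2 = (norm \<tau>)\<^sup>2"
    unfolding cmod_power2 by (simp_all add: gram_matrix_def inner_complex_def power2_eq_square)
  ultimately have "det ?A * trace (B ** matrix_inv ?A) = 0"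
    using trace_mult_inv_2[of ?A B] tr by (cases "det ?A = 0") (auto simp: mult_ac)
  then have "trace (B ** matrix_inv ?A) = 0"
    using nz by (simp add: det_gram)
  then have "B \<in> T0 ?A" "0 \<in> T0 ?A" using sym
    by (auto simp: T0_def transpose_def vec_eq_iff trace_def matrix_matrix_mult_def)
  moreover have "(\<lambda>z\<in>upper_half_plane. dTheta B ?A z) = (\<lambda>z\<in>upper_half_plane. dTheta 0 ?A z)"
    using dT by (rule restrict_ext)
  ultimately have "\<not> inj_on (\<lambda>B. \<lambda>z\<in>upper_half_plane. dTheta B ?A z) (T0 ?A)"
    using \<open>B \<noteq> 0\<close> unfolding inj_on_def by blast
  then show ?thesis
    unfolding Theta_degenerate_at_def using basis by blast
qed

theorem mainTheorem8:
  fixes \<tau> :: complex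
  assumes "\<tau> \<in> F"
  shows "Theta_degenerate_at (Lambda \<tau>) \<longleftrightarrow> \<tau> \<in> l1 \<union> l2 \<union> l3"
proof
  assume "Theta_degenerate_at (Lambda \<tau>)"
  then show "\<tau> \<in> l1 \<union> l2 \<union> l3"
    using interior_not_degenerate[of \<tau>] assms
    by (force simp: F_def l1_def l2_def l3_def upper_half_plane_def)
next
  have \<tau>: "Im \<tau> > 0" using assms by (simp add: F_def upper_half_plane_def)
  have eqI: "norm u = norm v" if "(norm u)\<^sup>2 = (norm v)\<^sup>2" for u v :: complex
    using that by (simp add: power2_eq_iff_nonneg)
  assume "\<tau> \<in> l1 \<union> l2 \<union> l3"
  \<comment> \<open>The first two cases use the reflection in the imaginary axis, which contains \<open>\<tau>\<close>,
    respectively \<open>2 \<tau> - 1\<close>; the third uses the reflection exchanging \<open>1\<close> and \<open>\<tau>\<close>.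
    In the coordinates \<open>m, n\<close> the forms are \<open>2 m n\<close>, \<open>(2 m + n) n\<close> and \<open>m\<^sup>2 - n\<^sup>2\<close>.\<close>
  then consider "Re \<tau> = 0" | "Re \<tau> = 1/2" | "norm \<tau> = 1" by (auto simp: l1_def l2_def l3_def)
  then show "Theta_degenerate_at (Lambda \<tau>)"
  proof cases
    case 1
    show ?thesis
      by (rule degenerate_of_symmetry[OF \<tau>, where \<sigma>="\<lambda>l. vector [- l $ 1, l $ 2]"
            and B="vector [vector [0, 1], vector [1, 0]]"])
         (use 1 in \<open>auto intro!: eqI simp: vec_eq_iff forall_2 quad_form_explicit transpose_def cmod_power2\<close>)
  next
    case 2
    have "norm (of_int (- m - n) + of_int n * \<tau>) = norm (of_int m + of_int n * \<tau>)" for m n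
    proof (rule eqI)
      show "(norm (of_int (- m - n) + of_int n * \<tau>))\<^sup>2 = (norm (of_int m + of_int n * \<tau>))\<^sup>2"
        unfolding cmod_power2 by (simp add: 2 power2_eq_square algebra_simps)
    qed
    then show ?thesis
      by (intro degenerate_of_symmetry[OF \<tau>, where \<sigma>="\<lambda>l. vector [- l $ 1 - l $ 2, l $ 2]"
            and B="vector [vector [0, 1], vector [1, 1]]"])
         (use 2 in \<open>auto simp: vec_eq_iff forall_2 quad_form_explicit transpose_def
            power2_eq_square algebra_simps\<close>)
  next
    case 3
    have c: "(Re \<tau>)\<^sup>2 + (Im \<tau>)\<^sup>2 = 1" using 3 by (simp flip: cmod_power2)
    have "norm (of_int n + of_int m * \<tau>) = norm (of_int m + of_int n * \<tau>)" for m n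
    proof (rule eqI)
      show "(norm (of_int n + of_int m * \<tau>))\<^sup>2 = (norm (of_int m + of_int n * \<tau>))\<^sup>2"
        unfolding cmod_power2 using c by (simp, algebra)
    qed
    then show ?thesis
      by (intro degenerate_of_symmetry[OF \<tau>, where \<sigma>="\<lambda>l. vector [l $ 2, l $ 1]"
            and B="vector [vector [1, 0], vector [0, -1]]"])
         (use 3 in \<open>auto simp: vec_eq_iff forall_2 quad_form_explicit transpose_def\<close>)
  qed
qed

end
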